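(* Let $H$ be a Hilbert space, let $A$ be a linear, closed, densely defined operator in $H$, and let $a>0$ be a constant. Let $T=A^*A$, $Q=AA^*$, $T_a=T+aI$, $Q_a=Q+aI$, and let $S$ denote the closure of the operator $T_a^{-1}A^*$ with domain $D(A^* )$. Then for any $f_\delta\in H$ the functional $$F(u)=\|Au-f_\delta\|^2+a\|u\|^2,\qquad u\in D(A),$$ has a unique global minimizer $u_{a,\delta}$, and $$u_{a,\delta}=Sf_\delta=A^*Q_a^{-1}f_\delta .$$
   Context: $D(\cdot)$ denotes the domain of an operator; "an operator in $H$" means a linear map $D(A)\subset H\to H$, possibly unbounded. $T=A^*A$ and $Q=AA^*$ are the nonnegative selfadjoint operators on their natural domains $D(T)=\{u\in D(A):Au\in D(A^* )\}$ and $D(Q)=\{u\in D(A^* ):A^*u\in D(A)\}$, and $I$ is the identity. The operator $T_a^{-1}A^*$, originally defined on $D(A^* )$, is closable and its closure $S$ is a bounded operator defined on all of $H$. *)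

theory Defs
  imports "HOL-Analysis.Analysis"
begin

text \<open>
  Scalars: a normed field over the reals with a conjugation. Because the norm is multiplicative,
  the only models up to isomorphism are the reals (trivial conjugation) and the complex numbers,
  so a theorem over this class covers real and complex Hilbert spaces alike.
\<close>

class real_or_complex = real_normed_field +
  fixes scnj :: "'a \<Rightarrow> 'a"
  assumes scnj_add: "scnj (x + y) = scnj x + scnj y"
    and scnj_mult: "scnj (x * y) = scnj x * scnj y"
    and scnj_scnj: "scnj (scnj x) = x"
    and scnj_scaleR: "scnj (r *\<^sub>R x) = r *\<^sub>R scnj x"
    and mult_scnj: "x * scnj x = (norm x)\<^sup>2 *\<^sub>R 1"

instantiation real :: real_or_complex
begin
definition scnj_real :: "real \<Rightarrow> real" where "scnj_real x = x"
instance by standard (auto simp: scnj_real_def power2_eq_square)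
end

instantiation complex :: real_or_complex
begin
definition scnj_complex :: "complex \<Rightarrow> complex" where "scnj_complex = cnj"
instance by standard
  (auto simp: scnj_complex_def scaleR_conv_of_real complex_norm_square simp flip: of_real_power)
end

text \<open>
  The norm, the topology and the completeness are those of the class \<open>banach\<close>; the locale adds the
  scalar multiplication by 'k and the inner product, linear in the first argument, that induces
  the norm.
\<close>

locale hilbert_space = vector_space smul
  for smul :: "'k::real_or_complex \<Rightarrow> 'h::banach \<Rightarrow> 'h" +
  fixes ip :: "'h \<Rightarrow> 'h \<Rightarrow> 'k"
  assumes scale_of_real: "smul (of_real r) x = r *\<^sub>R x"
    and ip_add_left: "ip (x + y) z = ip x z + ip y z"
    and ip_scale_left: "ip (smul c x) y = c * ip x y"
    and ip_commute: "ip y x = scnj (ip x y)"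
    and ip_self: "ip x x = of_real ((norm x)\<^sup>2)"

lemma hilbert_space_real_inner:
  "hilbert_space scaleR (inner :: 'h::{real_inner, banach} \<Rightarrow> 'h \<Rightarrow> real)"
  by unfold_locales
    (auto simp: scnj_real_def inner_commute power2_norm_eq_inner algebra_simps)

lemma hilbert_space_complex: "hilbert_space (*) (\<lambda>x y :: complex. x * cnj y)"
  by unfold_locales
    (simp_all add: scnj_complex_def scaleR_conv_of_real algebra_simps
      flip: complex_norm_square)

text \<open>
  An operator in H is a partial function \<open>A :: 'h \<rightharpoonup> 'h\<close>: its domain is \<open>dom A\<close>, its graph is
  \<open>Map.graph A\<close>, and composition \<open>\<circ>\<^sub>m\<close> of partial functions carries the natural domain, e.g.
  \<open>dom (B \<circ>\<^sub>m A) = {u \<in> dom A. the (A u) \<in> dom B}\<close>.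
\<close>

definition linear_operator :: "('k \<Rightarrow> 'h \<Rightarrow> 'h) \<Rightarrow> ('h::ab_group_add \<rightharpoonup> 'h) \<Rightarrow> bool" where
  "linear_operator smul A \<longleftrightarrow>
     A 0 = Some 0 \<and>
     (\<forall>x y x' y'. A x = Some x' \<longrightarrow> A y = Some y' \<longrightarrow> A (x + y) = Some (x' + y')) \<and>
     (\<forall>c x x'. A x = Some x' \<longrightarrow> A (smul c x) = Some (smul c x'))"

definition closed_operator :: "('h::topological_space \<rightharpoonup> 'h) \<Rightarrow> bool" where
  "closed_operator A \<longleftrightarrow> closed (Map.graph A)"

definition densely_defined :: "('h::topological_space \<rightharpoonup> 'h) \<Rightarrow> bool" where
  "densely_defined A \<longleftrightarrow> closure (dom A) = UNIV"

text \<open>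
  The operator with a given graph. If a linear relation R is not single-valued, then no point has
  exactly one image under R, and \<open>operator_of R\<close> is nowhere defined.
\<close>

definition operator_of :: "('h \<times> 'h) set \<Rightarrow> 'h \<rightharpoonup> 'h" where
  "operator_of R x = (if \<exists>!y. (x, y) \<in> R then Some (THE y. (x, y) \<in> R) else None)"

lemma operator_of_eq_Some:
  "operator_of R x = Some y \<longleftrightarrow> (x, y) \<in> R \<and> (\<forall>z. (x, z) \<in> R \<longrightarrow> z = y)"
proof (cases "\<exists>!y. (x, y) \<in> R")
  case True
  then show ?thesis
    using theI'[OF True] unfolding operator_of_def by auto
next
  case False
  then show ?thesis
    unfolding operator_of_def by auto
qed

lemma graph_operator_of:
  assumes "single_valued R"
  shows "Map.graph (operator_of R) = R"
  using assms unfolding single_valued_def Map.graph_def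
  by (auto simp: operator_of_eq_Some)

definition adjoint_operator :: "('h \<Rightarrow> 'h \<Rightarrow> 'k) \<Rightarrow> ('h \<rightharpoonup> 'h) \<Rightarrow> 'h \<rightharpoonup> 'h" where
  "adjoint_operator ip A = operator_of {(v, w). \<forall>u\<in>dom A. ip (the (A u)) v = ip u w}"

definition inverse_operator :: "('h \<rightharpoonup> 'h) \<Rightarrow> 'h \<rightharpoonup> 'h" where
  "inverse_operator B = operator_of {(w, u). B u = Some w}"

definition closure_operator :: "('h::topological_space \<rightharpoonup> 'h) \<Rightarrow> 'h \<rightharpoonup> 'h" where
  "closure_operator B = operator_of (closure (Map.graph B))"

definition plus_scaled_id :: "('h::real_vector \<rightharpoonup> 'h) \<Rightarrow> real \<Rightarrow> 'h \<rightharpoonup> 'h" where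
  "plus_scaled_id B a u = map_option (\<lambda>w. w + a *\<^sub>R u) (B u)"

end

theory Submission
  imports Defs
begin

text \<open>
  Projecting \<open>(0, f)\<close> orthogonally onto the closed subspace of all \<open>(\<surd>a x, A x)\<close> yields \<open>u\<close> and \<open>v\<close>
  with \<open>f = v + A u\<close> and \<open>A* v = a u\<close>. For \<open>x\<close> in the domain of \<open>A\<close>, Pythagoras turns this into
  \<open>F x = F u + \<parallel>A (x - u)\<parallel>\<^sup>2 + a \<parallel>x - u\<parallel>\<^sup>2\<close>, so \<open>u\<close> is the unique minimizer. Applying \<open>A\<close> to
  \<open>A* v = a u\<close> gives \<open>(Q + a) (v / a) = f\<close>. If \<open>f\<close> lies in the domain of \<open>A*\<close>, applying \<open>A*\<close> to
  \<open>f = v + A u\<close> gives \<open>(T + a) u = A* f\<close>. Finally \<open>f \<mapsto> u\<close> is bounded, because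
  \<open>\<parallel>f\<parallel>\<^sup>2 = \<parallel>v\<parallel>\<^sup>2 + \<parallel>A u\<parallel>\<^sup>2 + 2 a \<parallel>u\<parallel>\<^sup>2\<close>, and the domain of \<open>A*\<close> is dense, so the closure of
  \<open>T\<^sub>a\<^sup>-\<^sup>1 A*\<close> is this map.
\<close>

section \<open>Orthogonal projection\<close>

context hilbert_space
begin

section \<open>Inner product algebra over the abstract scalars\<close>

lemma scnj_0 [simp]: "scnj (0::'k) = 0"
  using scnj_scaleR[of 0 "0::'k"] by simp

lemma ip_zero_left [simp]: "ip 0 y = 0"
  using ip_add_left[of 0 0 y] by simp

lemma ip_minus_left: "ip (- x) y = - ip x y"
  using ip_add_left[of x "- x" y] by (simp add: eq_neg_iff_add_eq_0 add.commute)

lemma ip_diff_left: "ip (x - y) z = ip x z - ip y z"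
  using ip_add_left[of x "- y" z] by (simp add: ip_minus_left)

lemma ip_add_right: "ip x (y + z) = ip x y + ip x z"
  by (metis ip_commute ip_add_left scnj_add)

lemma ip_zero_right [simp]: "ip x 0 = 0"
  using ip_add_right[of x 0 0] by simp

lemma ip_minus_right: "ip x (- y) = - ip x y"
  using ip_add_right[of x y "- y"] by (simp add: eq_neg_iff_add_eq_0 add.commute)

lemma ip_diff_right: "ip x (y - z) = ip x y - ip x z"
  using ip_add_right[of x y "- z"] by (simp add: ip_minus_right)

lemma ip_scale_right: "ip x (smul c y) = scnj c * ip x y"
  by (metis ip_commute ip_scale_left scnj_mult)

lemma ip_scaleR_left: "ip (r *\<^sub>R x) y = of_real r * ip x y"
  by (metis ip_scale_left scale_of_real)

lemma scnj_of_real [simp]: "scnj (of_real r :: 'k) = of_real r"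
proof -
  \<comment> \<open>\<open>scnj\<close> is an involution, hence surjective, and multiplicative, so
    \<open>scnj 1\<close> is again a unit.\<close>
  have one: "scnj (1::'k) = 1"
    by (metis mult.right_neutral mult.commute scnj_mult scnj_scnj)
  show ?thesis
    using scnj_scaleR[of r "1::'k"] by (simp add: one of_real_def)
qed

lemma ip_scaleR_right: "ip x (r *\<^sub>R y) = of_real r * ip x y"
  by (metis ip_scale_right scale_of_real scnj_of_real)

lemmas ip_simps = ip_add_left ip_add_right ip_diff_left ip_diff_right ip_minus_left ip_minus_right
  ip_scaleR_left ip_scaleR_right

lemma ip_eq_0_commute: "ip x y = 0 \<longleftrightarrow> ip y x = 0"
  by (metis ip_commute scnj_0)

text \<open>Inner products live in \<open>'k\<close>, norms in the reals. Norm identities are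
  therefore computed in \<open>'k\<close> and brought back by injectivity of \<open>of_real\<close>;
  this expansion is the usual starting point.\<close>

lemma of_real_norm_add_sq:
  "of_real ((norm (x + y))\<^sup>2) = of_real ((norm x)\<^sup>2) + ip x y + ip y x + of_real ((norm y)\<^sup>2)"
  unfolding ip_self[symmetric] by (simp add: ip_add_left ip_add_right)

lemma pythagoras:
  assumes "ip x y = 0"
  shows "(norm (x + y))\<^sup>2 = (norm x)\<^sup>2 + (norm y)\<^sup>2"
proof -
  have "(of_real ((norm (x + y))\<^sup>2) :: 'k) = of_real ((norm x)\<^sup>2 + (norm y)\<^sup>2)"
    using assms ip_eq_0_commute[of x y] of_real_norm_add_sq[of x y] by (simp del: of_real_power)
  then show ?thesis
    by (simp only: of_real_eq_iff)
qed

lemma parallelogram: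
  fixes x y :: 'h
  shows "(norm (x + y))\<^sup>2 + (norm (x - y))\<^sup>2 = 2 * (norm x)\<^sup>2 + 2 * (norm y)\<^sup>2"
proof -
  have "(of_real ((norm (x + y))\<^sup>2 + (norm (x - y))\<^sup>2) :: 'k) = of_real (2 * (norm x)\<^sup>2 + 2 * (norm y)\<^sup>2)"
    by (simp only: of_real_add of_real_mult of_real_numeral ip_self[symmetric]) (simp add: ip_simps)
  then show ?thesis
    by (simp only: of_real_eq_iff)
qed

lemma norm_smul: "norm (smul c x) = norm c * norm x"
proof -
  have "(of_real ((norm (smul c x))\<^sup>2) :: 'k) = (c * scnj c) * ip x x"
    unfolding ip_self[symmetric] by (simp add: ip_scale_left ip_scale_right mult.assoc)
  also have "\<dots> = of_real ((norm c * norm x)\<^sup>2)"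
    by (simp add: mult_scnj ip_self power_mult_distrib scaleR_conv_of_real)
  finally have "(norm (smul c x))\<^sup>2 = (norm c * norm x)\<^sup>2"
    by (simp only: of_real_eq_iff)
  then show ?thesis
    by (simp add: power2_eq_iff_nonneg)
qed

lemma bounded_linear_smul: "bounded_linear (smul c)"
proof (rule bounded_linear_intro[where K = "norm c"])
  show "smul c (r *\<^sub>R x) = r *\<^sub>R smul c x" for r x
    by (metis scale_left_commute scale_of_real)
qed (simp_all add: scale_right_distrib norm_smul mult.commute)

section \<open>Closed subspaces, nearest points and orthogonality\<close>

lemma subspace_scaleR: "subspace M \<Longrightarrow> x \<in> M \<Longrightarrow> r *\<^sub>R x \<in> M"
  by (metis scale_of_real subspace_scale)

lemma subspace_closure:
  assumes "subspace M"
  shows "subspace (closure M)"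
proof (rule subspaceI)
  show "0 \<in> closure M"
    using subspace_0[OF assms] closure_subset by blast
next
  fix x y assume "x \<in> closure M" "y \<in> closure M"
  then obtain f g where "\<And>n. f n \<in> M" "f \<longlonglongrightarrow> x" "\<And>n. g n \<in> M" "g \<longlonglongrightarrow> y"
    unfolding closure_sequential by blast
  then show "x + y \<in> closure M"
    unfolding closure_sequential
    by (intro exI[of _ "\<lambda>n. f n + g n"]) (simp add: subspace_add[OF assms] tendsto_add)
next
  fix c x assume "x \<in> closure M"
  then obtain f where "\<And>n. f n \<in> M" "f \<longlonglongrightarrow> x"
    unfolding closure_sequential by blast
  then show "smul c x \<in> closure M"
    unfolding closure_sequential
    by (intro exI[of _ "\<lambda>n. smul c (f n)"])
      (simp add: subspace_scale[OF assms] bounded_linear.tendsto[OF bounded_linear_smul])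
qed

text \<open>The sets of almost nearest points are closed, nonempty and nested. The parallelogram law
  makes their diameters shrink to 0, so by completeness they have a common point (Cantor's
  intersection theorem).\<close>

lemma closest_point_exists:
  assumes "subspace M" "closed M"
  obtains p where "p \<in> M" "\<And>x. x \<in> M \<Longrightarrow> norm (f - p) \<le> norm (f - x)"
proof -
  define d where "d = (INF x\<in>M. (norm (f - x))\<^sup>2)"
  have bdd: "bdd_below ((\<lambda>x. (norm (f - x))\<^sup>2) ` M)"
    by (rule bdd_belowI[of _ 0]) auto
  have ne: "M \<noteq> {}"
    using subspace_0[OF assms(1)] by blast
  have d_le: "d \<le> (norm (f - x))\<^sup>2" if "x \<in> M" for x
    unfolding d_def using bdd that by (rule cINF_lower)
  define C where "C n = {x \<in> M. (norm (f - x))\<^sup>2 \<le> d + inverse (real (Suc n))}" for n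
  have "closed (C n)" for n
  proof -
    have "C n = M \<inter> {x. (norm (f - x))\<^sup>2 \<le> d + inverse (real (Suc n))}"
      unfolding C_def by blast
    moreover have "closed {x. (norm (f - x))\<^sup>2 \<le> d + inverse (real (Suc n))}"
      by (intro closed_Collect_le continuous_intros)
    ultimately show ?thesis
      using assms(2) by auto
  qed
  moreover have "C n \<noteq> {}" for n
  proof -
    have "d < d + inverse (real (Suc n))"
      by simp
    then obtain x where "x \<in> M" "(norm (f - x))\<^sup>2 < d + inverse (real (Suc n))"
      using cINF_less_iff[OF ne bdd, of "d + inverse (real (Suc n))"] unfolding d_def[symmetric] by blast
    then show ?thesis
      unfolding C_def by fastforce
  qed
  moreover have "C n \<subseteq> C m" if "m \<le> n" for m n
  proof -
    have "inverse (real (Suc n)) \<le> inverse (real (Suc m))"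
      using that by (intro le_imp_inverse_le) auto
    then show ?thesis
      unfolding C_def by (auto intro: order_trans)
  qed
  moreover have "\<exists>n. \<forall>x\<in>C n. \<forall>y\<in>C n. dist x y < e" if "0 < e" for e
  proof -
    \<comment> \<open>Two points of \<open>C n\<close> turn out to satisfy
      \<open>(dist x y)^2 \<le> 4 * inverse (Suc n)\<close>, hence the factor 4.\<close>
    have "0 < e\<^sup>2 / 4"
      using that by simp
    then obtain n where n: "inverse (real (Suc n)) < e\<^sup>2 / 4"
      using reals_Archimedean by blast
    have "dist x y < e" if x: "x \<in> C n" and y: "y \<in> C n" for x y
    proof -
      \<comment> \<open>The midpoint lies in \<open>M\<close>, so its squared distance to
        \<open>f\<close> is at least \<open>d\<close>; this bounds the sum term of the parallelogram
        law for \<open>f - x\<close> and \<open>f - y\<close> from below.\<close>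
      have "(1/2) *\<^sub>R (x + y) \<in> M"
        using x y unfolding C_def by (auto intro: subspace_scaleR subspace_add assms)
      then have "4 * d \<le> 4 * (norm (f - (1/2) *\<^sub>R (x + y)))\<^sup>2"
        using d_le by auto
      also have "\<dots> = (norm (2 *\<^sub>R (f - (1/2) *\<^sub>R (x + y))))\<^sup>2"
        by (simp add: power_mult_distrib)
      also have "2 *\<^sub>R (f - (1/2) *\<^sub>R (x + y)) = (f - x) + (f - y)"
        by (simp add: algebra_simps scaleR_2)
      finally have "4 * d \<le> (norm ((f - x) + (f - y)))\<^sup>2" .
      moreover have "(norm ((f - x) - (f - y)))\<^sup>2 = (dist x y)\<^sup>2"
        by (simp add: dist_norm norm_minus_commute)
      ultimately have "(dist x y)\<^sup>2 \<le> 2 * (norm (f - x))\<^sup>2 + 2 * (norm (f - y))\<^sup>2 - 4 * d"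
        using parallelogram[of "f - x" "f - y"] by linarith
      also have "\<dots> < e\<^sup>2"
        using x y n unfolding C_def by auto
      finally show ?thesis
        using \<open>0 < e\<close> by (simp add: power2_less_imp_less)
    qed
    then show ?thesis
      by blast
  qed
  ultimately obtain p where p: "\<And>n. p \<in> C n"
    using decreasing_closed_nest[of C] by blast
  have "(norm (f - p))\<^sup>2 \<le> d"
  proof (rule field_le_epsilon)
    fix e :: real assume "0 < e"
    then obtain n where "inverse (real (Suc n)) < e"
      using reals_Archimedean by blast
    then show "(norm (f - p))\<^sup>2 \<le> d + e"
      using p[of n] unfolding C_def by auto
  qed
  moreover have "p \<in> M"
    using p unfolding C_def by blast
  ultimately show ?thesis
    using that d_le by (meson norm_ge_zero order_trans power2_le_imp_le)
qed

text \<open>Test with the coefficient of the projection of \<open>w\<close> onto the line through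
  \<open>x\<close>: subtracting that projection lowers the squared norm by
  \<open>(norm (ip x w))^2 / (norm x)^2\<close>.\<close>

lemma orthogonal_if_norm_le:
  assumes "\<And>c. norm w \<le> norm (w - smul c x)"
  shows "ip x w = 0"
proof (cases "x = 0")
  case False
  define z where "z = ip x w"
  define t where "t = inverse ((norm x)\<^sup>2)"
  \<comment> \<open>This is \<open>ip w x\<close> divided by \<open>(norm x)^2\<close>, since
    \<open>ip w x = scnj z\<close>.\<close>
  define c where "c = of_real t * scnj z"
  have wx: "ip w x = scnj z"
    unfolding z_def by (rule ip_commute)
  have zz: "z * scnj z = of_real ((norm z)\<^sup>2)"
    by (simp add: mult_scnj of_real_def)
  have tx: "t * (norm x)\<^sup>2 = 1"
    using False unfolding t_def by simp
  have "(of_real ((norm (w - smul c x))\<^sup>2) :: 'k)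
      = of_real ((norm w)\<^sup>2) - c * z - scnj c * scnj z + c * scnj c * of_real ((norm x)\<^sup>2)"
    unfolding ip_self[symmetric]
    by (simp add: ip_simps ip_scale_left ip_scale_right wx z_def[symmetric] algebra_simps)
  also have "c * z = of_real (t * (norm z)\<^sup>2)"
    unfolding c_def of_real_mult zz[symmetric] by (simp add: ac_simps)
  also have "scnj c * scnj z = of_real (t * (norm z)\<^sup>2)"
    unfolding c_def of_real_mult zz[symmetric] by (simp add: scnj_mult scnj_scnj ac_simps)
  also have "c * scnj c * of_real ((norm x)\<^sup>2) = of_real (t * (norm z)\<^sup>2 * (t * (norm x)\<^sup>2))"
    unfolding c_def of_real_mult zz[symmetric] by (simp add: scnj_mult scnj_scnj ac_simps)
  finally have "(of_real ((norm (w - smul c x))\<^sup>2) :: 'k) = of_real ((norm w)\<^sup>2 - t * (norm z)\<^sup>2)"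
    unfolding tx by simp
  then have "(norm (w - smul c x))\<^sup>2 = (norm w)\<^sup>2 - t * (norm z)\<^sup>2"
    by (simp only: of_real_eq_iff)
  moreover have "(norm w)\<^sup>2 \<le> (norm (w - smul c x))\<^sup>2"
    using assms by (simp add: power_mono)
  ultimately have "t * (norm z)\<^sup>2 \<le> 0"
    by simp
  moreover have "t > 0"
    using False unfolding t_def by simp
  ultimately show ?thesis
    by (simp add: mult_le_0_iff z_def)
qed simp

theorem orthogonal_projection_exists:
  assumes "subspace M" "closed M"
  obtains p where "p \<in> M" "\<And>x. x \<in> M \<Longrightarrow> ip x (f - p) = 0"
proof -
  obtain p where p: "p \<in> M" "\<And>x. x \<in> M \<Longrightarrow> norm (f - p) \<le> norm (f - x)"
    using closest_point_exists[OF assms] by blast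
  have "ip x (f - p) = 0" if "x \<in> M" for x
  proof (rule orthogonal_if_norm_le)
    fix c
    have "p + smul c x \<in> M"
      using assms(1) p(1) that by (simp add: subspace_add subspace_scale)
    from p(2)[OF this] show "norm (f - p) \<le> norm (f - p - smul c x)"
      by (simp add: diff_diff_eq)
  qed
  with p(1) that show ?thesis
    by blast
qed

text \<open>By Pythagoras a point \<open>x\<close> of \<open>D\<close> has distance at least
  \<open>norm z\<close> from \<open>z\<close>, while density provides points arbitrarily close to
  \<open>z\<close>.\<close>

lemma eq_0_if_orthogonal_dense:
  assumes "closure D = UNIV" "\<And>x. x \<in> D \<Longrightarrow> ip x z = 0"
  shows "z = 0"
proof -
  have "norm z \<le> 0 + e" if "0 < e" for e
  proof -
    obtain x where x: "x \<in> D" "dist x z < e"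
      using assms(1) \<open>0 < e\<close> by (metis UNIV_I closure_approachable)
    have "(norm z)\<^sup>2 \<le> (norm (x + - z))\<^sup>2"
      using pythagoras[of x "- z"] assms(2)[OF x(1)] by (simp add: ip_minus_right)
    then have "norm z \<le> dist x z"
      by (simp add: dist_norm)
    with x(2) show ?thesis
      by simp
  qed
  then show ?thesis
    using field_le_epsilon[of "norm z" 0] by simp
qed

text \<open>The residual of the projection onto \<open>closure M\<close> is orthogonal to
  \<open>M\<close>, hence zero.\<close>

lemma dense_if_orthogonal_trivial:
  assumes "subspace M" "\<And>z. (\<And>x. x \<in> M \<Longrightarrow> ip x z = 0) \<Longrightarrow> z = 0"
  shows "closure M = UNIV"
proof -
  have "f \<in> closure M" for f
  proof -
    obtain p where p: "p \<in> closure M" "\<And>x. x \<in> closure M \<Longrightarrow> ip x (f - p) = 0"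
      using orthogonal_projection_exists[OF subspace_closure[OF assms(1)] closed_closure] by blast
    then have "f - p = 0"
      using assms(2) closure_subset by (metis subsetD)
    with p(1) show ?thesis
      by simp
  qed
  then show ?thesis
    by blast
qed

end

text \<open>The norm of the product type is Euclidean, so the sum of the two inner products induces
  it. This makes orthogonal projection available in the space that contains the graph of an
  operator.\<close>

lemma hilbert_space_prod:
  assumes "hilbert_space smul (ip :: 'h::banach \<Rightarrow> 'h \<Rightarrow> 'k::real_or_complex)"
  shows "hilbert_space (\<lambda>c p. (smul c (fst p), smul c (snd p)))
     (\<lambda>p q. ip (fst p) (fst q) + ip (snd p) (snd q))"
proof -
  interpret hilbert_space smul ip
    by (rule assms)
  show ?thesis
  proof unfold_locales
    fix x y :: "'h \<times> 'h"
    show "ip (fst y) (fst x) + ip (snd y) (snd x) = scnj (ip (fst x) (fst y) + ip (snd x) (snd y))"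
      by (metis ip_commute scnj_add)
    show "ip (fst x) (fst x) + ip (snd x) (snd x) = of_real ((norm x)\<^sup>2)"
      by (simp add: norm_prod_def ip_self)
  qed (auto simp: ip_simps ip_scale_left scale_right_distrib scale_left_distrib scale_of_real prod_eq_iff
      algebra_simps)
qed

section \<open>Closed densely defined operators\<close>

lemma inverse_operator_eq_Some:
  "inverse_operator B w = Some u \<longleftrightarrow> B u = Some w \<and> (\<forall>x. B x = Some w \<longrightarrow> x = u)"
  unfolding inverse_operator_def operator_of_eq_Some by simp

lemma plus_scaled_id_eq_Some:
  "plus_scaled_id B a u = Some w \<longleftrightarrow> (\<exists>z. B u = Some z \<and> z + a *\<^sub>R u = w)"
  unfolding plus_scaled_id_def by auto

text \<open>The graph of a continuous map is closed, so it contains the closure of the graph of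
  \<open>B\<close>. Conversely, \<open>x \<mapsto> (x, R x)\<close> is continuous and carries the
  closure of \<open>dom B\<close>, the whole space, into that closure.\<close>

lemma closure_operator_eq_continuous_extension:
  fixes B :: "'h::real_normed_vector \<rightharpoonup> 'h"
  assumes "closure (dom B) = UNIV" "continuous_on UNIV R" "\<And>x y. B x = Some y \<Longrightarrow> y = R x"
  shows "closure_operator B x = Some (R x)"
proof -
  let ?g = "\<lambda>x. (x, R x)"
  have graph: "Map.graph B = ?g ` dom B"
    using assms(3) unfolding Map.graph_def by fastforce
  have "closed (range ?g)"
  proof -
    have "range ?g = {p. R (fst p) = snd p}"
      by (force simp: image_iff)
    moreover have "closed {p. R (fst p) = snd p}"
      by (intro closed_Collect_eq continuous_on_compose2[OF assms(2)] continuous_intros) auto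
    ultimately show ?thesis
      by simp
  qed
  then have "closure (Map.graph B) \<subseteq> range ?g"
    unfolding graph by (intro closure_minimal) auto
  moreover have "?g ` closure (dom B) \<subseteq> closure (?g ` dom B)"
    using assms(1,2)
    by (intro image_closure_subset continuous_intros closure_subset) auto
  ultimately have "closure (Map.graph B) = range ?g"
    unfolding graph assms(1) by blast
  then show ?thesis
    unfolding closure_operator_def operator_of_eq_Some by auto
qed

locale closed_dense_operator = hilbert_space smul ip
  for smul :: "'k::real_or_complex \<Rightarrow> 'h::banach \<Rightarrow> 'h" and ip :: "'h \<Rightarrow> 'h \<Rightarrow> 'k" +
  fixes A :: "'h \<rightharpoonup> 'h" and a :: real
  assumes linear: "linear_operator smul A"
    and closed: "closed_operator A"
    and dense: "densely_defined A"
    and pos: "a > 0"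
begin

section \<open>The operator and its adjoint\<close>

lemma A_0: "A 0 = Some 0"
  and A_add: "A x = Some x' \<Longrightarrow> A y = Some y' \<Longrightarrow> A (x + y) = Some (x' + y')"
  and A_smul: "A x = Some x' \<Longrightarrow> A (smul c x) = Some (smul c x')"
  using linear unfolding linear_operator_def by auto

lemma A_scaleR: "A x = Some x' \<Longrightarrow> A (r *\<^sub>R x) = Some (r *\<^sub>R x')"
  by (metis A_smul scale_of_real)

lemma A_diff: "A x = Some x' \<Longrightarrow> A y = Some y' \<Longrightarrow> A (x - y) = Some (x' - y')"
  using A_add[of x x' "- y" "- y'"] A_scaleR[of y y' "-1"] by simp

abbreviation A_star :: "'h \<rightharpoonup> 'h" where "A_star \<equiv> adjoint_operator ip A"

text \<open>Density of \<open>dom A\<close> makes the adjoint relation single-valued, so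
  \<open>operator_of\<close> keeps every pair of it.\<close>

lemma A_star_eq_Some:
  "A_star v = Some w \<longleftrightarrow> (\<forall>x x'. A x = Some x' \<longrightarrow> ip x' v = ip x w)"
proof -
  have "z = w" if *: "\<forall>x x'. A x = Some x' \<longrightarrow> ip x' v = ip x w"
    "\<forall>x x'. A x = Some x' \<longrightarrow> ip x' v = ip x z" for z
  proof -
    have "ip x (z - w) = 0" if "x \<in> dom A" for x
      using * that by (auto simp: ip_diff_right)
    then have "z - w = 0"
      using dense unfolding densely_defined_def by (rule eq_0_if_orthogonal_dense[rotated])
    then show ?thesis
      by simp
  qed
  moreover have "(\<forall>u\<in>dom A. ip (the (A u)) v = ip u z) \<longleftrightarrow> (\<forall>x x'. A x = Some x' \<longrightarrow> ip x' v = ip x z)" for z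
    by (auto simp: dom_def)
  ultimately show ?thesis
    unfolding adjoint_operator_def operator_of_eq_Some mem_Collect_eq case_prod_conv by blast
qed

lemma A_star_0: "A_star 0 = Some 0"
  and A_star_add: "A_star x = Some x' \<Longrightarrow> A_star y = Some y' \<Longrightarrow> A_star (x + y) = Some (x' + y')"
  and A_star_diff: "A_star x = Some x' \<Longrightarrow> A_star y = Some y' \<Longrightarrow> A_star (x - y) = Some (x' - y')"
  and A_star_smul: "A_star x = Some x' \<Longrightarrow> A_star (smul c x) = Some (smul c x')"
  and A_star_scaleR: "A_star x = Some x' \<Longrightarrow> A_star (r *\<^sub>R x) = Some (r *\<^sub>R x')"
  unfolding A_star_eq_Some by (metis ip_zero_right ip_add_right ip_diff_right ip_scale_right ip_scaleR_right)+

text \<open>\<open>regularized f u\<close> is \<open>A* (f - A u) = a u\<close>, the Euler equation of the functional.\<close>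

definition regularized :: "'h \<Rightarrow> 'h \<Rightarrow> bool" where
  "regularized f u \<longleftrightarrow> (\<exists>v. A u = Some (f - v) \<and> A_star v = Some (a *\<^sub>R u))"

section \<open>Solvability, linearity and stability of the Euler equation\<close>

lemma regularized_exists: "\<exists>u. regularized f u"
proof -
  interpret P: hilbert_space "\<lambda>c p. (smul c (fst p), smul c (snd p))"
    "\<lambda>p q. ip (fst p) (fst q) + ip (snd p) (snd q)"
    by (rule hilbert_space_prod) unfold_locales
  define s where "s = sqrt a"
  have s: "s > 0" "s * s = a"
    using pos unfolding s_def by auto
  \<comment> \<open>These are the pairs \<open>(s x, A x)\<close>, written as a preimage of the
    graph of \<open>A\<close> under a continuous map, so that closedness carries over.\<close>
  define M where "M = {p. A (inverse s *\<^sub>R fst p) = Some (snd p)}"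
  have M_iff: "(s *\<^sub>R x, y) \<in> M \<longleftrightarrow> A x = Some y" for x y
    unfolding M_def using s by simp
  have "P.subspace M"
  proof (rule P.subspaceI)
    show "(smul c (fst p), smul c (snd p)) \<in> M" if "p \<in> M" for c p
      using A_smul[of "inverse s *\<^sub>R fst p" "snd p" c] that unfolding M_def
      by (metis (mono_tags) fst_conv mem_Collect_eq scale_left_commute scale_of_real snd_conv)
  qed (auto simp: M_def A_0 A_add scaleR_add_right)
  moreover have "closed M"
  proof -
    have "M = (\<lambda>p. (inverse s *\<^sub>R fst p, snd p)) -` Map.graph A"
      unfolding M_def Map.graph_def by auto
    moreover have "closed \<dots>"
      using closed unfolding closed_operator_def
      by (intro continuous_closed_vimage continuous_intros) auto
    ultimately show ?thesis
      by simp
  qed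
  ultimately obtain p where p: "p \<in> M"
    "\<And>q. q \<in> M \<Longrightarrow> ip (fst q) (fst ((0, f) - p)) + ip (snd q) (snd ((0, f) - p)) = 0"
    using P.orthogonal_projection_exists[of M "(0, f)"] by blast
  define u where "u = inverse s *\<^sub>R fst p"
  have fst_p: "fst p = s *\<^sub>R u"
    using s unfolding u_def by simp
  have "A u = Some (snd p)"
    using p(1) unfolding M_def u_def by simp
  moreover have "A_star (f - snd p) = Some (a *\<^sub>R u)"
    unfolding A_star_eq_Some
  proof (intro allI impI)
    fix x x' assume "A x = Some x'"
    then have "(s *\<^sub>R x, x') \<in> M"
      by (simp add: M_iff)
    \<comment> \<open>The residual is \<open>(- s u, f - A u)\<close>. Its orthogonality to
      \<open>(s x, A x)\<close> turns the weight \<open>s\<close> into \<open>s * s = a\<close>,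
      which is the defining relation of the adjoint.\<close>
    from p(2)[OF this] have "ip x' (f - snd p) = of_real (s * s) * ip x u"
      by (simp add: fst_p ip_simps algebra_simps)
    then show "ip x' (f - snd p) = ip x (a *\<^sub>R u)"
      by (simp only: s ip_scaleR_right)
  qed
  ultimately show ?thesis
    unfolding regularized_def by (intro exI[of _ u] exI[of _ "f - snd p"]) simp
qed

lemma regularized_add:
  assumes "regularized f u" "regularized g x"
  shows "regularized (f + g) (u + x)"
proof -
  obtain v w where "A u = Some (f - v)" "A_star v = Some (a *\<^sub>R u)"
    "A x = Some (g - w)" "A_star w = Some (a *\<^sub>R x)"
    using assms unfolding regularized_def by blast
  then show ?thesis
    using A_add[of u "f - v" x "g - w"] A_star_add[of v "a *\<^sub>R u" w "a *\<^sub>R x"]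
    unfolding regularized_def
    by (intro exI[of _ "v + w"]) (simp add: algebra_simps)
qed

lemma regularized_scaleR:
  assumes "regularized f u"
  shows "regularized (r *\<^sub>R f) (r *\<^sub>R u)"
proof -
  obtain v where "A u = Some (f - v)" "A_star v = Some (a *\<^sub>R u)"
    using assms unfolding regularized_def by blast
  then show ?thesis
    using A_scaleR[of u "f - v" r] A_star_scaleR[of v "a *\<^sub>R u" r]
    unfolding regularized_def
    by (intro exI[of _ "r *\<^sub>R v"]) (simp add: algebra_simps)
qed

text \<open>As \<open>A_star v = a u\<close>, both cross terms of
  \<open>norm (v + (f - v))^2\<close> are real and equal to \<open>a * (norm u)^2\<close>. The
  identity serves the norm bound and the density of \<open>dom A_star\<close>.\<close>

lemma norm_sq_regularized:
  assumes "A u = Some (f - v)" "A_star v = Some (a *\<^sub>R u)"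
  shows "(norm f)\<^sup>2 = (norm v)\<^sup>2 + (norm (f - v))\<^sup>2 + 2 * a * (norm u)\<^sup>2"
proof -
  have *: "ip (f - v) v = of_real (a * (norm u)\<^sup>2)"
    using assms unfolding A_star_eq_Some by (simp add: ip_scaleR_right ip_self)
  then have "ip v (f - v) = of_real (a * (norm u)\<^sup>2)"
    by (metis ip_commute scnj_of_real)
  with * have "(of_real ((norm f)\<^sup>2) :: 'k)
      = of_real ((norm v)\<^sup>2 + (norm (f - v))\<^sup>2 + 2 * a * (norm u)\<^sup>2)"
    using of_real_norm_add_sq[of v "f - v"] by simp
  then show ?thesis
    by (simp only: of_real_eq_iff)
qed

lemma regularized_norm_le:
  assumes "regularized f u"
  shows "norm u \<le> norm f * inverse (sqrt a)"
proof -
  obtain v where "A u = Some (f - v)" "A_star v = Some (a *\<^sub>R u)"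
    using assms unfolding regularized_def by blast
  then have "(norm f)\<^sup>2 = (norm v)\<^sup>2 + (norm (f - v))\<^sup>2 + a * (norm u)\<^sup>2 + a * (norm u)\<^sup>2"
    by (simp add: norm_sq_regularized)
  moreover have "0 \<le> a * (norm u)\<^sup>2"
    using pos by simp
  ultimately have "a * (norm u)\<^sup>2 \<le> (norm f)\<^sup>2"
    by (smt (verit) zero_le_power2)
  then have "(sqrt a * norm u)\<^sup>2 \<le> (norm f)\<^sup>2"
    using pos by (simp add: power_mult_distrib)
  then have "sqrt a * norm u \<le> norm f"
    by (rule power2_le_imp_le) simp
  moreover have "sqrt a > 0"
    using pos by simp
  ultimately show ?thesis
    unfolding divide_inverse[symmetric] by (simp only: pos_le_divide_eq mult.commute)
qed

text \<open>The difference of two solutions solves the equation with datum 0, where the norm bound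
  forces it to vanish.\<close>

lemma regularized_unique:
  assumes "regularized f u" "regularized f x"
  shows "u = x"
proof -
  have "regularized (f + (-1) *\<^sub>R f) (u + (-1) *\<^sub>R x)"
    using assms by (intro regularized_add regularized_scaleR)
  from regularized_norm_le[OF this] show ?thesis
    by simp
qed

text \<open>The solution operator of the Euler equation. Both operators in the theorem are
  identified with it.\<close>

definition R :: "'h \<Rightarrow> 'h" where "R f = (THE u. regularized f u)"

lemma regularized_iff: "regularized f u \<longleftrightarrow> u = R f"
proof -
  obtain x where x: "regularized f x"
    using regularized_exists by blast
  then have "R f = x"
    unfolding R_def by (rule the_equality) (rule regularized_unique[OF _ x])
  with x show ?thesis
    using regularized_unique[OF _ x, of u] by auto
qed

lemma bounded_linear_R: "bounded_linear R"
proof (rule bounded_linear_intro)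
  show "R (x + y) = R x + R y" for x y
    using regularized_add[of x "R x" y "R y"] by (simp add: regularized_iff)
  show "R (r *\<^sub>R x) = r *\<^sub>R R x" for r x
    using regularized_scaleR[of x "R x" r] by (simp add: regularized_iff)
  show "norm (R x) \<le> norm x * inverse (sqrt a)" for x
    using regularized_norm_le by (simp add: regularized_iff)
qed

text \<open>Solve the Euler equation with datum \<open>z\<close> orthogonal to
  \<open>dom A_star\<close>. Then \<open>v\<close> lies in \<open>dom A_star\<close>, so
  \<open>z\<close> is orthogonal to \<open>v\<close>, and Pythagoras together with
  \<open>norm_sq_regularized\<close> leaves \<open>2 * (norm v)^2 + 2 * a * (norm u)^2 = 0\<close>.
  Hence \<open>z = A 0 = 0\<close>.\<close>

lemma dense_A_star: "closure (dom A_star) = UNIV"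
proof (rule dense_if_orthogonal_trivial)
  show "subspace (dom A_star)"
    by (rule subspaceI) (auto intro: A_star_0 A_star_add A_star_smul)
next
  fix z assume z: "\<And>x. x \<in> dom A_star \<Longrightarrow> ip x z = 0"
  obtain u v where uv: "A u = Some (z - v)" "A_star v = Some (a *\<^sub>R u)"
    using regularized_exists unfolding regularized_def by blast
  have "ip v z = 0"
    using z uv(2) by blast
  then have "(norm (z - v))\<^sup>2 = (norm z)\<^sup>2 + (norm v)\<^sup>2"
    using pythagoras[of z "- v"] by (simp add: ip_minus_right ip_eq_0_commute[of z v])
  with norm_sq_regularized[OF uv] have "2 * (norm v)\<^sup>2 + 2 * a * (norm u)\<^sup>2 = 0"
    by simp
  then have "v = 0" "u = 0"
    using pos by (smt (verit) mult_nonneg_nonneg mult_pos_pos zero_le_power2 zero_less_power2 norm_eq_zero)+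
  then show "z = 0"
    using uv(1) A_0 by simp
qed

section \<open>The two operator formulas for the solution\<close>

lemma inverse_T_A_star_eq_R:
  assumes "A_star f = Some g"
  shows "(inverse_operator (plus_scaled_id (A_star \<circ>\<^sub>m A) a) \<circ>\<^sub>m A_star) f = Some (R f)"
proof -
  \<comment> \<open>Put \<open>v = f - A u\<close>. Because \<open>f\<close> is in
    \<open>dom A_star\<close>, \<open>v\<close> lies there exactly when \<open>A u\<close> does, and
    the two equations coincide. Unique solvability then gives the inverse.\<close>
  have "plus_scaled_id (A_star \<circ>\<^sub>m A) a u = Some g \<longleftrightarrow> regularized f u" for u
  proof
    assume "plus_scaled_id (A_star \<circ>\<^sub>m A) a u = Some g"
    then obtain y z where "A u = Some y" "A_star y = Some z" "z + a *\<^sub>R u = g"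
      by (auto simp: plus_scaled_id_eq_Some map_comp_Some_iff)
    with A_star_diff[OF assms this(2)] show "regularized f u"
      unfolding regularized_def by (intro exI[of _ "f - y"]) auto
  next
    assume "regularized f u"
    then obtain v where "A u = Some (f - v)" "A_star v = Some (a *\<^sub>R u)"
      unfolding regularized_def by blast
    with A_star_diff[OF assms this(2)] show "plus_scaled_id (A_star \<circ>\<^sub>m A) a u = Some g"
      by (auto simp: plus_scaled_id_eq_Some map_comp_Some_iff)
  qed
  with assms show ?thesis
    by (simp add: map_comp_Some_iff inverse_operator_eq_Some regularized_iff)
qed

lemma closure_inverse_T_A_star:
  "closure_operator (inverse_operator (plus_scaled_id (A_star \<circ>\<^sub>m A) a) \<circ>\<^sub>m A_star) f = Some (R f)"
  (is "closure_operator ?B f = _")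
proof (rule closure_operator_eq_continuous_extension)
  have "dom ?B = dom A_star"
    using inverse_T_A_star_eq_R by (fastforce simp: map_comp_Some_iff)
  then show "closure (dom ?B) = UNIV"
    by (simp add: dense_A_star)
  show "continuous_on UNIV R"
    by (rule bounded_linear.continuous_on[OF bounded_linear_R continuous_on_id])
  show "y = R x" if "?B x = Some y" for x y
    using that inverse_T_A_star_eq_R[of x] by (auto simp: map_comp_Some_iff)
qed

lemma A_star_inverse_Q:
  "(A_star \<circ>\<^sub>m inverse_operator (plus_scaled_id (A \<circ>\<^sub>m A_star) a)) f = Some (R f)"
proof -
  obtain v where v: "A (R f) = Some (f - v)" "A_star v = Some (a *\<^sub>R R f)"
    using regularized_iff[of f "R f"] unfolding regularized_def by auto
  define w where "w = inverse a *\<^sub>R v"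
  have w: "A_star w = Some (R f)" "v = a *\<^sub>R w"
    using A_star_scaleR[OF v(2), of "inverse a"] pos unfolding w_def by auto
  have "plus_scaled_id (A \<circ>\<^sub>m A_star) a w = Some f"
    using v(1) w by (simp add: plus_scaled_id_eq_Some map_comp_Some_iff)
  moreover have "x = w" if Qx: "plus_scaled_id (A \<circ>\<^sub>m A_star) a x = Some f" for x
  proof -
    \<comment> \<open>For any other preimage \<open>x\<close>, the vector \<open>a x\<close> takes
      the place of \<open>v\<close>: \<open>A y = f - a x\<close> and
      \<open>A_star (a x) = a y\<close>. So \<open>y = R f\<close>, hence
      \<open>a x = v\<close>.\<close>
    obtain y z where yz: "A_star x = Some y" "A y = Some z" "z + a *\<^sub>R x = f"
      using Qx by (auto simp: plus_scaled_id_eq_Some map_comp_Some_iff)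
    then have "regularized f y"
      using A_star_scaleR[OF yz(1), of a] unfolding regularized_def
      by (intro exI[of _ "a *\<^sub>R x"]) auto
    then have "z = f - v"
      using v(1) yz(2) by (simp add: regularized_iff)
    with yz(3) w(2) pos show ?thesis
      by auto
  qed
  ultimately have "inverse_operator (plus_scaled_id (A \<circ>\<^sub>m A_star) a) f = Some w"
    unfolding inverse_operator_eq_Some by blast
  with w(1) show ?thesis
    by (simp add: map_comp_Some_iff)
qed

section \<open>The functional and its minimizer\<close>

lemma functional_eq:
  assumes "A u = Some (f - v)" "A_star v = Some (a *\<^sub>R u)" "A x = Some y"
  shows "(norm (y - f))\<^sup>2 + a * (norm x)\<^sup>2
    = (norm v)\<^sup>2 + a * (norm u)\<^sup>2 + (norm (y - (f - v)))\<^sup>2 + a * (norm (x - u))\<^sup>2"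
proof -
  define p where "p = y - (f - v)"
  \<comment> \<open>Here \<open>p = A (x - u)\<close>. Through \<open>A_star v = a u\<close> the
    cross terms of \<open>norm (p - v)^2\<close> cancel those of
    \<open>a * norm (u + (x - u))^2\<close>.\<close>
  have pv: "ip p v = of_real a * ip (x - u) u"
    using assms(2) A_diff[OF assms(3,1)] unfolding A_star_eq_Some p_def
    by (metis ip_scaleR_right)
  then have vp: "ip v p = of_real a * ip u (x - u)"
    by (metis ip_commute scnj_mult scnj_of_real)
  have "y - f = p - v" "x = u + (x - u)"
    unfolding p_def by auto
  then have "(of_real ((norm (y - f))\<^sup>2 + a * (norm x)\<^sup>2) :: 'k) = ip (p - v) (p - v)
      + of_real a * (of_real ((norm u)\<^sup>2) + ip u (x - u) + ip (x - u) u + of_real ((norm (x - u))\<^sup>2))"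
    using of_real_norm_add_sq[of u "x - u"] by (simp add: ip_self)
  also have "\<dots> = of_real ((norm v)\<^sup>2 + a * (norm u)\<^sup>2 + (norm p)\<^sup>2 + a * (norm (x - u))\<^sup>2)"
    by (simp add: ip_diff_left[of p v] ip_diff_right[of _ p v] pv vp ip_self[of p] ip_self[of v] distrib_left)
  finally show ?thesis
    unfolding p_def by (simp only: of_real_eq_iff)
qed

lemma is_arg_min_functional_iff:
  "is_arg_min (\<lambda>u. (norm (the (A u) - f))\<^sup>2 + a * (norm u)\<^sup>2) (\<lambda>u. u \<in> dom A) x \<longleftrightarrow> x = R f"
  (is "is_arg_min ?F _ x \<longleftrightarrow> _")
proof -
  obtain v where v: "A (R f) = Some (f - v)" "A_star v = Some (a *\<^sub>R R f)"
    using regularized_iff[of f "R f"] unfolding regularized_def by auto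
  \<comment> \<open>The term \<open>norm (A x - A (R f))^2\<close> is dropped;
    \<open>a * (norm (x - R f))^2\<close> alone makes the inequality strict off \<open>R f\<close>,
    which yields minimality and uniqueness at once.\<close>
  have ge: "?F (R f) + a * (norm (x - R f))\<^sup>2 \<le> ?F x" if "x \<in> dom A" for x
    using that functional_eq[OF v] v(1) by fastforce
  then have "?F (R f) < ?F x" if "x \<in> dom A" "x \<noteq> R f" for x
    using that pos by (smt (verit) mult_pos_pos right_minus_eq zero_less_norm_iff zero_less_power)
  then show ?thesis
    using v(1) unfolding is_arg_min_def by (metis domI order_less_asym order_less_irrefl)
qed

end

theorem theorem3:
  fixes smul :: "'k::real_or_complex \<Rightarrow> 'h::banach \<Rightarrow> 'h"
    and ip :: "'h \<Rightarrow> 'h \<Rightarrow> 'k"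
    and A :: "'h \<rightharpoonup> 'h"
    and a :: real
    and f\<^sub>\<delta> :: 'h
  assumes "hilbert_space smul ip"
    and "linear_operator smul A"
    and "closed_operator A"
    and "densely_defined A"
    and "a > 0"
  shows
    "let A' = adjoint_operator ip A;
         T = A' \<circ>\<^sub>m A;
         Q = A \<circ>\<^sub>m A';
         T\<^sub>a = plus_scaled_id T a;
         Q\<^sub>a = plus_scaled_id Q a;
         S = closure_operator (inverse_operator T\<^sub>a \<circ>\<^sub>m A');
         F = (\<lambda>u. (norm (the (A u) - f\<^sub>\<delta>))\<^sup>2 + a * (norm u)\<^sup>2)
     in (\<exists>!u. is_arg_min F (\<lambda>u. u \<in> dom A) u) \<and>
        (\<forall>u. is_arg_min F (\<lambda>u. u \<in> dom A) u \<longrightarrow>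
           S f\<^sub>\<delta> = Some u \<and> (A' \<circ>\<^sub>m inverse_operator Q\<^sub>a) f\<^sub>\<delta> = Some u)"
proof -
  interpret closed_dense_operator smul ip A a
    using assms by (simp add: closed_dense_operator_def closed_dense_operator_axioms_def)
  show ?thesis
    unfolding Let_def Ex1_def is_arg_min_functional_iff closure_inverse_T_A_star A_star_inverse_Q
    by simp
qed

end
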